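(* Let $G_5^{\mathrm{p}}\subset \mathrm{G}\mathbb{I}_{\mathrm{p}}(4)$ be the group of pseudo-isotropic limit motions. The 1-parameter subgroups of $G_5^{\mathrm{p}}$ are given by $$\psi_t=\begin{pmatrix}1&0&0&a\,t\\ 0&1&0&b\,t\\ c_1t&c_2t&1&c\,t+(ac_1+bc_2)\frac{t^2}{2}\\ 0&0&0&1\end{pmatrix},\qquad t\in\mathbb{R},$$ with constants $a,b,c,c_1,c_2\in\mathbb{R}$. That is, every continuous group homomorphism $\psi:(\mathbb{R},+)\to G_5^{\mathrm{p}}$ is of this form for some $a,b,c,c_1,c_2\in\mathbb{R}$, and every choice of these constants gives such a homomorphism.
   Context: The pseudo-isotropic space $\mathbb{I}^3_{\mathrm{p}}$ is $\mathbb{R}^3$ with the degenerate inner product $\langle u,v\rangle_{pz}=u^1v^1-u^2v^2$ and, on isotropic vectors (those with $u^1=u^2=0$), the codistance $|u^3-v^3|$. $\mathrm{O}\mathbb{I}_{\mathrm{p}}(3)$ is the set of real $3\times 3$ matrices preserving $\langle\cdot,\cdot\rangle_{pz}$, and preserving the codistance on isotropic vectors. $\mathrm{G}\mathbb{I}_{\mathrm{p}}(4)$ is the group of matrices $\begin{pmatrix}A&\mathbf{a}\\0&1\end{pmatrix}\in GL(4,\mathbb{R})$ with $A\in\mathrm{O}\mathbb{I}_{\mathrm{p}}(3)$, $\mathbf{a}\in\mathbb{R}^3$; such a matrix represents the isometry $x\mapsto Ax+\mathbf{a}$. The top view plane is the $xy$-plane. The group $G_5^{\mathrm{p}}$ of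 limit motions consists of the motions which act in the top view plane as a pure translation or as the identity, i.e. of the matrices $$\begin{pmatrix}1&0&0&a\\0&1&0&b\\c_1&c_2&1&c\\0&0&0&1\end{pmatrix},\qquad a,b,c,c_1,c_2\in\mathbb{R}.$$ A 1-parameter subgroup $H$ of a group $G$ is a subgroup for which there is a surjective continuous group homomorphism $\psi:(\mathbb{R},+)\to H$; one identifies $H$ with $\psi$ and writes $\psi_t=\psi(t)$. *)

theory Defs
  imports "HOL-Analysis.Analysis" "HOL-Algebra.Group"
begin

definition pz_inner :: "real^3 \<Rightarrow> real^3 \<Rightarrow> real" where
  "pz_inner u v = u$1 * v$1 - u$2 * v$2"

definition isotropic :: "real^3 \<Rightarrow> bool" where
  "isotropic u \<longleftrightarrow> u$1 = 0 \<and> u$2 = 0"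

definition codist :: "real^3 \<Rightarrow> real^3 \<Rightarrow> real" where
  "codist u v = \<bar>u$3 - v$3\<bar>"

definition OIp3 :: "(real^3^3) set" where
  "OIp3 = {A. (\<forall>u v. pz_inner (A *v u) (A *v v) = pz_inner u v) \<and>
     (\<forall>u v. isotropic u \<and> isotropic v \<longrightarrow> codist (A *v u) (A *v v) = codist u v)}"

definition motion_matrix :: "real^3^3 \<Rightarrow> real^3 \<Rightarrow> real^4^4" where
  "motion_matrix A a = vector [
     vector [A$1$1, A$1$2, A$1$3, a$1],
     vector [A$2$1, A$2$2, A$2$3, a$2],
     vector [A$3$1, A$3$2, A$3$3, a$3],
     vector [0, 0, 0, 1]]"

definition GIp4 :: "(real^4^4) monoid" where
  "GIp4 = \<lparr>carrier = {M. invertible M \<and> (\<exists>A\<in>OIp3. \<exists>a. M = motion_matrix A a)},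
           mult = (**), one = mat 1\<rparr>"

definition limit_motion :: "real \<Rightarrow> real \<Rightarrow> real \<Rightarrow> real \<Rightarrow> real \<Rightarrow> real^4^4" where
  "limit_motion a b c c1 c2 = vector [
     vector [1, 0, 0, a],
     vector [0, 1, 0, b],
     vector [c1, c2, 1, c],
     vector [0, 0, 0, 1]]"

text \<open>The limit motions are taken in their explicit matrix form. An element of \<open>GIp4\<close>
  that acts on the top view plane as a translation may also have the entry \<open>-1\<close> instead of
  \<open>1\<close> in position (3,3), because the codistance only fixes that entry up to sign; these
  elements are not limit motions.\<close>

definition G5p :: "(real^4^4) monoid" where
  "G5p = GIp4\<lparr>carrier := {limit_motion a b c c1 c2 | a b c c1 c2. True}\<rparr>"

definition real_add_group :: "real monoid" where
  "real_add_group = \<lparr>carrier = UNIV, mult = (+), one = 0\<rparr>"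

definition continuous_hom :: "(real \<Rightarrow> 'a::topological_space) \<Rightarrow> 'a monoid \<Rightarrow> bool" where
  "continuous_hom \<psi> G \<longleftrightarrow> \<psi> \<in> hom real_add_group G \<and> continuous_on UNIV \<psi>"

definition one_parameter_subgroup :: "'a::topological_space set \<Rightarrow> 'a monoid \<Rightarrow> bool" where
  "one_parameter_subgroup H G \<longleftrightarrow>
     subgroup H G \<and> (\<exists>\<psi>. continuous_hom \<psi> (G\<lparr>carrier := H\<rparr>) \<and> range \<psi> = H)"

lemma vec4_simps [simp]:
  "(vector [x, y, z, w] :: 'a::zero^4) $ 1 = x"
  "(vector [x, y, z, w] :: 'a::zero^4) $ 2 = y"
  "(vector [x, y, z, w] :: 'a::zero^4) $ 3 = z"
  "(vector [x, y, z, w] :: 'a::zero^4) $ 4 = w"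
  unfolding vector_def by simp_all

lemma limit_motion_mult:
  "limit_motion a b c c1 c2 ** limit_motion a' b' c' d1 d2 =
   limit_motion (a + a') (b + b') (c + c' + c1 * a' + c2 * b') (c1 + d1) (c2 + d2)"
  by (simp add: vec_eq_iff forall_4 limit_motion_def matrix_matrix_mult_def sum_4)

lemma limit_motion_0: "limit_motion 0 0 0 0 0 = mat 1"
  by (simp add: vec_eq_iff forall_4 limit_motion_def mat_def)

lemma limit_motion_in_GIp4: "limit_motion a b c c1 c2 \<in> carrier GIp4"
proof -
  let ?N = "limit_motion (-a) (-b) (- c + c1 * a + c2 * b) (-c1) (-c2)"
  have "limit_motion a b c c1 c2 ** ?N = mat 1" "?N ** limit_motion a b c c1 c2 = mat 1"
    by (simp_all add: limit_motion_mult flip: limit_motion_0)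
  then have "invertible (limit_motion a b c c1 c2)"
    unfolding invertible_def by blast
  moreover have "vector [vector [1,0,0], vector [0,1,0], vector [c1,c2,1]] \<in> OIp3"
    by (simp add: OIp3_def pz_inner_def isotropic_def codist_def
        matrix_vector_mult_def sum_3)
  moreover have "limit_motion a b c c1 c2 =
      motion_matrix (vector [vector [1,0,0], vector [0,1,0], vector [c1,c2,1]]) (vector [a,b,c])"
    by (simp add: limit_motion_def motion_matrix_def)
  ultimately show ?thesis
    by (auto simp: GIp4_def)
qed

lemma isotropic_iff_pz_inner: "isotropic u \<longleftrightarrow> (\<forall>v. pz_inner u v = 0)"
proof
  assume "\<forall>v. pz_inner u v = 0"
  then have "pz_inner u (vector [1,0,0]) = 0" "pz_inner u (vector [0,1,0]) = 0"
    by auto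
  then show "isotropic u"
    by (simp add: pz_inner_def isotropic_def)
qed (simp add: pz_inner_def isotropic_def)

lemma OIp3_inverse:
  assumes "A \<in> OIp3"
  obtains B where "B ** A = mat 1" "A ** B = mat 1"
proof -
  have "u = 0" if u: "A *v u = 0" for u
  proof -
    have "pz_inner u v = 0" for v
    proof -
      have "pz_inner u v = pz_inner (A *v u) (A *v v)"
        using assms by (simp add: OIp3_def)
      then show ?thesis
        by (simp add: u pz_inner_def)
    qed
    then have iso: "isotropic u"
      by (simp add: isotropic_iff_pz_inner)
    moreover have "isotropic 0"
      by (simp add: isotropic_def)
    ultimately have "codist (A *v u) (A *v 0) = codist u 0"
      using assms unfolding OIp3_def by blast
    then show "u = 0"
      using iso by (simp add: u codist_def isotropic_def vec_eq_iff forall_3)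
  qed
  then obtain B where "B ** A = mat 1"
    using matrix_left_invertible_ker[of A] by blast
  then show ?thesis
    using matrix_left_right_inverse that by blast
qed

lemma OIp3_isotropic:
  assumes "A \<in> OIp3" "isotropic u"
  shows "isotropic (A *v u)"
proof -
  obtain B where B: "A ** B = mat 1"
    using OIp3_inverse assms(1) by metis
  have "pz_inner (A *v u) v = 0" for v
  proof -
    have "pz_inner (A *v u) (A *v (B *v v)) = pz_inner u (B *v v)"
      using assms(1) by (simp add: OIp3_def)
    also have "\<dots> = 0"
      using assms(2) isotropic_iff_pz_inner by blast
    finally show ?thesis
      by (simp add: matrix_vector_mul_assoc B)
  qed
  then show ?thesis
    by (simp add: isotropic_iff_pz_inner)
qed

lemma OIp3_mult:
  assumes "A \<in> OIp3" "B \<in> OIp3"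
  shows "A ** B \<in> OIp3"
  using assms OIp3_isotropic[OF assms(2)]
  by (simp add: OIp3_def flip: matrix_vector_mul_assoc)

lemma OIp3_inverse_mem:
  assumes "A \<in> OIp3" and B: "A ** B = mat 1"
  shows "B \<in> OIp3"
proof -
  have AB: "A *v (B *v u) = u" for u
    by (simp add: matrix_vector_mul_assoc B)
  have inner: "pz_inner (B *v u) (B *v v) = pz_inner u v" for u v
  proof -
    have "pz_inner (A *v (B *v u)) (A *v (B *v v)) = pz_inner (B *v u) (B *v v)"
      using assms(1) by (simp add: OIp3_def)
    then show ?thesis
      by (simp add: AB)
  qed
  have iso: "isotropic (B *v u)" if "isotropic u" for u
  proof -
    have "pz_inner (B *v u) w = 0" for w
    proof -
      have "pz_inner (A *v (B *v u)) (A *v w) = pz_inner (B *v u) w"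
        using assms(1) by (simp add: OIp3_def)
      then show ?thesis
        using that by (simp add: AB isotropic_iff_pz_inner)
    qed
    then show ?thesis
      by (simp add: isotropic_iff_pz_inner)
  qed
  have "codist (B *v u) (B *v v) = codist u v" if "isotropic u" "isotropic v" for u v
  proof -
    have "codist (A *v (B *v u)) (A *v (B *v v)) = codist (B *v u) (B *v v)"
      using assms(1) iso[OF that(1)] iso[OF that(2)] by (simp add: OIp3_def)
    then show ?thesis
      by (simp add: AB)
  qed
  with inner show ?thesis
    by (simp add: OIp3_def)
qed

lemma motion_matrix_mult:
  "motion_matrix A a ** motion_matrix B b = motion_matrix (A ** B) (A *v b + a)"
  by (simp add: vec_eq_iff forall_4 motion_matrix_def matrix_matrix_mult_def
      matrix_vector_mult_def sum_4 sum_3)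

lemma motion_matrix_1: "motion_matrix (mat 1) 0 = mat 1"
  by (simp add: vec_eq_iff forall_4 motion_matrix_def mat_def)

lemma group_GIp4: "group GIp4"
proof (rule groupI)
  show "x \<otimes>\<^bsub>GIp4\<^esub> y \<in> carrier GIp4" if xy: "x \<in> carrier GIp4" "y \<in> carrier GIp4" for x y
  proof -
    obtain A a B b where "x = motion_matrix A a" "y = motion_matrix B b"
      and AB: "A \<in> OIp3" "B \<in> OIp3"
      using xy by (auto simp: GIp4_def)
    then have "x ** y = motion_matrix (A ** B) (A *v b + a)"
      by (simp add: motion_matrix_mult)
    moreover have "invertible (x ** y)"
      using xy by (simp add: GIp4_def invertible_mult)
    ultimately show ?thesis
      using OIp3_mult[OF AB] by (auto simp: GIp4_def)
  qed
  have "mat 1 \<in> OIp3"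
    by (simp add: OIp3_def)
  moreover have "invertible (mat 1 :: real^4^4)"
    unfolding invertible_def by (intro exI[of _ "mat 1"]) simp
  ultimately show "\<one>\<^bsub>GIp4\<^esub> \<in> carrier GIp4"
    using motion_matrix_1[symmetric] by (auto simp: GIp4_def)
  show "\<And>x y z. x \<otimes>\<^bsub>GIp4\<^esub> y \<otimes>\<^bsub>GIp4\<^esub> z = x \<otimes>\<^bsub>GIp4\<^esub> (y \<otimes>\<^bsub>GIp4\<^esub> z)"
    by (simp add: GIp4_def matrix_mul_assoc)
  show "\<And>x. \<one>\<^bsub>GIp4\<^esub> \<otimes>\<^bsub>GIp4\<^esub> x = x"
    by (simp add: GIp4_def)
  fix x assume "x \<in> carrier GIp4"
  then obtain A a where x: "x = motion_matrix A a" and A: "A \<in> OIp3"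
    by (auto simp: GIp4_def)
  obtain B where B: "B ** A = mat 1" "A ** B = mat 1"
    using OIp3_inverse A by metis
  let ?y = "motion_matrix B (- (B *v a))"
  have *: "?y ** x = mat 1"
    by (simp add: x motion_matrix_mult B motion_matrix_1)
  then have "invertible ?y"
    using matrix_left_right_inverse unfolding invertible_def by blast
  then show "\<exists>y\<in>carrier GIp4. y \<otimes>\<^bsub>GIp4\<^esub> x = \<one>\<^bsub>GIp4\<^esub>"
    using * OIp3_inverse_mem[OF A B(2)] by (intro bexI[of _ ?y]) (auto simp: GIp4_def)
qed

lemma G5p_subset_GIp4: "carrier G5p \<subseteq> carrier GIp4"
  using limit_motion_in_GIp4 by (auto simp: G5p_def)

lemma group_G5p: "group G5p"
proof (rule groupI)
  show "\<And>x y. x \<in> carrier G5p \<Longrightarrow> y \<in> carrier G5p \<Longrightarrow> x \<otimes>\<^bsub>G5p\<^esub> y \<in> carrier G5p"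
    by (auto simp: G5p_def GIp4_def limit_motion_mult) blast
  show "\<one>\<^bsub>G5p\<^esub> \<in> carrier G5p"
    by (auto simp: G5p_def GIp4_def simp flip: limit_motion_0) blast
  show "\<And>x y z. x \<otimes>\<^bsub>G5p\<^esub> y \<otimes>\<^bsub>G5p\<^esub> z = x \<otimes>\<^bsub>G5p\<^esub> (y \<otimes>\<^bsub>G5p\<^esub> z)"
    by (simp add: G5p_def GIp4_def matrix_mul_assoc)
  show "\<And>x. \<one>\<^bsub>G5p\<^esub> \<otimes>\<^bsub>G5p\<^esub> x = x"
    by (simp add: G5p_def GIp4_def)
  fix x assume "x \<in> carrier G5p"
  then obtain a b c c1 c2 where x: "x = limit_motion a b c c1 c2"
    by (auto simp: G5p_def)
  have "limit_motion (-a) (-b) (- c + c1 * a + c2 * b) (-c1) (-c2) ** x = mat 1"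
    by (simp add: x limit_motion_mult flip: limit_motion_0)
  then show "\<exists>y\<in>carrier G5p. y \<otimes>\<^bsub>G5p\<^esub> x = \<one>\<^bsub>G5p\<^esub>"
    by (auto simp: G5p_def GIp4_def) blast
qed

lemma subgroup_G5p: "subgroup (carrier G5p) GIp4"
proof (rule group.group_incl_imp_subgroup[OF group_GIp4 G5p_subset_GIp4])
  have "GIp4\<lparr>carrier := carrier G5p\<rparr> = G5p"
    by (simp add: G5p_def)
  then show "group (GIp4\<lparr>carrier := carrier G5p\<rparr>)"
    using group_G5p by simp
qed

end

theory Submission
  imports Defs
begin

text \<open>
  Multiplying limit motions adds the entries \<open>a, b, c1, c2\<close>, and adds the entry \<open>c\<close> up to the
  bilinear term \<open>c1 * a' + c2 * b'\<close>. Along a continuous homomorphism \<open>\<psi>\<close> the first four entries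
  are therefore continuous additive functions of \<open>t\<close>, hence linear (Cauchy's functional
  equation, \<open>additive_continuous_imp_linear\<close>). The remaining entry \<open>R\<close> then satisfies
  \<open>R (s + t) = R s + R t + k * s * t\<close> with \<open>k = a * c1 + b * c2\<close>. Since \<open>k * t\<^sup>2 / 2\<close> solves the
  same equation, \<open>R t - k * t\<^sup>2 / 2\<close> is additive, so it is linear too, which gives the stated form.
  Conversely, expanding the square shows that every such curve is a homomorphism
  (\<open>limit_motion_curve_add\<close>).

  One-parameter subgroups are by definition subgroups parametrised by a continuous homomorphism;
  images of homomorphisms are subgroups, so they are exactly the ranges of these curves
  (\<open>one_parameter_subgroup_iff_range\<close>).
\<close>

text \<open>
  Additivity gives \<open>f q = f 1 * q\<close> for rational \<open>q\<close>, and continuity extends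
  the equation to the closure of the rationals.
\<close>

lemma additive_continuous_imp_linear:
  fixes f :: "real \<Rightarrow> real"
  assumes add: "\<And>s t. f (s + t) = f s + f t" and cont: "continuous_on UNIV f"
  shows "f t = f 1 * t"
proof -
  interpret additive f
    by standard (rule add)
  have nat: "f (of_nat n * t) = of_nat n * f t" for n t
    by (induction n) (simp_all add: zero add distrib_right)
  have int: "f (of_int k * t) = of_int k * f t" for k t
  proof (cases "k \<ge> 0")
    case True
    then show ?thesis
      using nat[of "nat k" t] by simp
  next
    case False
    then show ?thesis
      using nat[of "nat (- k)" "- t"] by (simp add: minus)
  qed
  have rat: "f q - f 1 * q = 0" if "q \<in> \<rat>" for q
  proof -
    obtain m n where q: "q = of_int m / of_int n" and n: "n \<noteq> 0"
      using \<open>q \<in> \<rat>\<close> by (auto simp: Rats_eq_int_div_int)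
    have "of_int n * f q = f (of_int m * 1)"
      using int[of n q] n by (simp add: q)
    also have "\<dots> = of_int m * f 1"
      by (rule int)
    finally show ?thesis
      using n by (simp add: q field_simps)
  qed
  have "f t - f 1 * t = 0"
  proof (rule continuous_constant_on_closure[where S = "\<rat>" and f = "\<lambda>t. f t - f 1 * t"])
    show "continuous_on (closure \<rat>) (\<lambda>t. f t - f 1 * t)"
      unfolding Rats_closure_real by (intro continuous_intros cont)
  qed (simp_all add: rat Rats_closure_real)
  then show ?thesis
    by simp
qed

lemma limit_motion_entries:
  "limit_motion a b c c1 c2 $ 1 $ 4 = a" "limit_motion a b c c1 c2 $ 2 $ 4 = b"
  "limit_motion a b c c1 c2 $ 3 $ 4 = c"
  "limit_motion a b c c1 c2 $ 3 $ 1 = c1" "limit_motion a b c c1 c2 $ 3 $ 2 = c2"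
  by (simp_all add: limit_motion_def)

lemma limit_motion_eq_iff:
  "limit_motion a b c c1 c2 = limit_motion a' b' c' d1 d2 \<longleftrightarrow>
   a = a' \<and> b = b' \<and> c = c' \<and> c1 = d1 \<and> c2 = d2"
  by (metis limit_motion_entries)

definition limit_motion_curve :: "real \<Rightarrow> real \<Rightarrow> real \<Rightarrow> real \<Rightarrow> real \<Rightarrow> real \<Rightarrow> real^4^4" where
  "limit_motion_curve a b c c1 c2 t =
     limit_motion (a * t) (b * t) (c * t + (a * c1 + b * c2) * (t\<^sup>2 / 2)) (c1 * t) (c2 * t)"

text \<open>
  The cross term \<open>s * t\<close> of \<open>(s + t)\<^sup>2 / 2\<close> accounts for the failure of the entry \<open>c\<close> to be
  additive under multiplication.
\<close>

lemma limit_motion_curve_add: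
  "limit_motion_curve a b c c1 c2 (s + t) =
   limit_motion_curve a b c c1 c2 s ** limit_motion_curve a b c c1 c2 t"
proof -
  have "c * (s + t) + (a * c1 + b * c2) * ((s + t)\<^sup>2 / 2) =
        c * s + (a * c1 + b * c2) * (s\<^sup>2 / 2) + (c * t + (a * c1 + b * c2) * (t\<^sup>2 / 2))
        + c1 * s * (a * t) + c2 * s * (b * t)"
    by (simp add: power2_eq_square field_simps)
  then show ?thesis
    unfolding limit_motion_curve_def limit_motion_mult limit_motion_eq_iff by (simp only: distrib_left)
qed

lemma continuous_on_limit_motion:
  assumes "continuous_on S a" "continuous_on S b" "continuous_on S c"
    "continuous_on S c1" "continuous_on S c2"
  shows "continuous_on S (\<lambda>t. limit_motion (a t) (b t) (c t) (c1 t) (c2 t))"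
proof -
  have entry: "continuous_on S (\<lambda>t. limit_motion (a t) (b t) (c t) (c1 t) (c2 t) $ i $ j)" for i j
    using assms exhaust_4[of i] exhaust_4[of j] by (auto simp: limit_motion_def)
  have "continuous_on S (\<lambda>t. \<chi> i j. limit_motion (a t) (b t) (c t) (c1 t) (c2 t) $ i $ j)"
    by (intro continuous_on_vec_lambda entry)
  then show ?thesis
    by simp
qed

lemma continuous_hom_G5p_iff:
  "continuous_hom \<psi> G5p \<longleftrightarrow>
   (\<forall>t. \<psi> t \<in> carrier G5p) \<and> (\<forall>s t. \<psi> (s + t) = \<psi> s ** \<psi> t) \<and> continuous_on UNIV \<psi>"
  by (simp add: continuous_hom_def hom_def real_add_group_def G5p_def GIp4_def Pi_iff)

lemma continuous_hom_G5p_iff_curve: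
  "continuous_hom \<psi> G5p \<longleftrightarrow> (\<exists>a b c c1 c2. \<psi> = limit_motion_curve a b c c1 c2)"
proof
  assume "continuous_hom \<psi> G5p"
  then have carrier: "\<And>t. \<psi> t \<in> carrier G5p" and hom: "\<And>s t. \<psi> (s + t) = \<psi> s ** \<psi> t"
    and cont: "continuous_on UNIV \<psi>"
    by (auto simp: continuous_hom_G5p_iff)
  define A B R C D where entries: "A = (\<lambda>t. \<psi> t $ 1 $ 4)" "B = (\<lambda>t. \<psi> t $ 2 $ 4)"
    "R = (\<lambda>t. \<psi> t $ 3 $ 4)" "C = (\<lambda>t. \<psi> t $ 3 $ 1)" "D = (\<lambda>t. \<psi> t $ 3 $ 2)"
  have \<psi>: "\<psi> t = limit_motion (A t) (B t) (R t) (C t) (D t)" for t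
    using carrier[of t] by (auto simp: G5p_def entries limit_motion_entries)
  have add: "A (s + t) = A s + A t" "B (s + t) = B s + B t"
    "R (s + t) = R s + R t + C s * A t + D s * B t"
    "C (s + t) = C s + C t" "D (s + t) = D s + D t" for s t
    using hom[of s t] unfolding \<psi> limit_motion_mult limit_motion_eq_iff by simp_all
  have conts: "continuous_on UNIV A" "continuous_on UNIV B" "continuous_on UNIV R"
    "continuous_on UNIV C" "continuous_on UNIV D"
    unfolding entries by (intro continuous_on_component cont)+
  define a b c1 c2 where "a = A 1" and "b = B 1" and "c1 = C 1" and "c2 = D 1"
  have lin: "A t = a * t" "B t = b * t" "C t = c1 * t" "D t = c2 * t" for t
    unfolding a_def b_def c1_def c2_def
    by (rule additive_continuous_imp_linear; (rule add | rule conts))+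
  \<comment> \<open>Subtracting the quadratic term removes the cross term \<open>(a * c1 + b * c2) * s * t\<close> from the
    equation for \<open>R\<close>.\<close>
  define Q where "Q = (\<lambda>t. R t - (a * c1 + b * c2) * (t\<^sup>2 / 2))"
  have add_Q: "Q (s + t) = Q s + Q t" for s t
    unfolding Q_def add(3) lin by (simp add: power2_eq_square field_simps)
  have cont_Q: "continuous_on UNIV Q"
    unfolding Q_def by (intro continuous_intros conts) simp
  have lin_Q: "Q t = Q 1 * t" for t
    using add_Q cont_Q by (rule additive_continuous_imp_linear)
  have "R t = Q 1 * t + (a * c1 + b * c2) * (t\<^sup>2 / 2)" for t
    using fun_cong[OF Q_def, of t] lin_Q[of t] by linarith
  then have "\<psi> = limit_motion_curve a b (Q 1) c1 c2"
    unfolding fun_eq_iff limit_motion_curve_def \<psi> lin by simp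
  then show "\<exists>a b c c1 c2. \<psi> = limit_motion_curve a b c c1 c2"
    by blast
next
  assume "\<exists>a b c c1 c2. \<psi> = limit_motion_curve a b c c1 c2"
  then obtain a b c c1 c2 where \<psi>: "\<psi> = limit_motion_curve a b c c1 c2"
    by blast
  have "\<psi> t \<in> carrier G5p" for t
    unfolding \<psi> limit_motion_curve_def G5p_def by simp blast
  moreover have "continuous_on UNIV \<psi>"
    unfolding \<psi> limit_motion_curve_def
    by (intro continuous_on_limit_motion continuous_intros) simp
  ultimately show "continuous_hom \<psi> G5p"
    by (simp add: continuous_hom_G5p_iff \<psi> limit_motion_curve_add)
qed

lemma group_real_add_group: "group real_add_group"
proof (rule groupI)
  show "\<exists>y\<in>carrier real_add_group. y \<otimes>\<^bsub>real_add_group\<^esub> x = \<one>\<^bsub>real_add_group\<^esub>" for x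
    by (auto simp: real_add_group_def intro: exI[of _ "- x"])
qed (simp_all add: real_add_group_def)

text \<open>
  The image of a homomorphism is a subgroup, and a homomorphism into a subgroup is one into the
  whole group. This reduces the classification of one-parameter subgroups to that of continuous
  homomorphisms into \<open>G\<close>.
\<close>

lemma one_parameter_subgroup_iff_range:
  assumes "group G"
  shows "one_parameter_subgroup H G \<longleftrightarrow> (\<exists>\<psi>. continuous_hom \<psi> G \<and> H = range \<psi>)"
proof
  assume "one_parameter_subgroup H G"
  then obtain \<psi> where H: "subgroup H G" and \<psi>: "continuous_hom \<psi> (G\<lparr>carrier := H\<rparr>)" "range \<psi> = H"
    by (auto simp: one_parameter_subgroup_def)
  have "continuous_hom \<psi> G"
    using \<psi>(1) subgroup.subset[OF H] by (auto simp: continuous_hom_def hom_def)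
  then show "\<exists>\<psi>. continuous_hom \<psi> G \<and> H = range \<psi>"
    using \<psi>(2) by blast
next
  assume "\<exists>\<psi>. continuous_hom \<psi> G \<and> H = range \<psi>"
  then obtain \<psi> where \<psi>: "continuous_hom \<psi> G" and H: "H = range \<psi>"
    by blast
  interpret group_hom real_add_group G \<psi>
    using \<psi> assms group_real_add_group
    by (simp add: group_hom_def group_hom_axioms_def continuous_hom_def)
  have "subgroup H G"
    using img_is_subgroup by (simp add: H real_add_group_def)
  moreover have "continuous_hom \<psi> (G\<lparr>carrier := H\<rparr>)"
    using \<psi> by (auto simp: continuous_hom_def hom_def H)
  ultimately show "one_parameter_subgroup H G"
    using H by (auto simp: one_parameter_subgroup_def)
qed

theorem theorem3p2:
  shows "(\<forall>\<psi> :: real \<Rightarrow> real^4^4.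
            continuous_hom \<psi> G5p \<longleftrightarrow>
            (\<exists>a b c c1 c2 :: real. \<forall>t. \<psi> t = vector [
               vector [1, 0, 0, a * t],
               vector [0, 1, 0, b * t],
               vector [c1 * t, c2 * t, 1, c * t + (a * c1 + b * c2) * (t\<^sup>2 / 2)],
               vector [0, 0, 0, 1]]))
       \<and> (\<forall>H :: (real^4^4) set.
            one_parameter_subgroup H G5p \<longleftrightarrow>
            (\<exists>a b c c1 c2 :: real. H = range (\<lambda>t. vector [
               vector [1, 0, 0, a * t],
               vector [0, 1, 0, b * t],
               vector [c1 * t, c2 * t, 1, c * t + (a * c1 + b * c2) * (t\<^sup>2 / 2)],
               vector [0, 0, 0, 1]])))"
proof -
  have "continuous_hom \<psi> G5p \<longleftrightarrow>
      (\<exists>a b c c1 c2. \<forall>t. \<psi> t = limit_motion_curve a b c c1 c2 t)" for \<psi>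
    by (simp add: continuous_hom_G5p_iff_curve fun_eq_iff)
  moreover have "one_parameter_subgroup H G5p \<longleftrightarrow>
      (\<exists>a b c c1 c2. H = range (\<lambda>t. limit_motion_curve a b c c1 c2 t))" for H
    unfolding one_parameter_subgroup_iff_range[OF group_G5p] continuous_hom_G5p_iff_curve
    by blast
  ultimately show ?thesis
    unfolding limit_motion_curve_def limit_motion_def by (intro conjI allI)
qed

end
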